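(* Let $\mathbb{K}$ be any field and let $\mathcal{E}$ be a finite-dimensional regular evolution algebra over $\mathbb{K}$ with natural basis $B=\{e_1,\dots,e_n\}$. Then every subalgebra $U$ of $\mathcal{E}$ admits a vector space basis $\{u_1,\dots,u_m\}$ whose elements have pairwise disjoint supports, i.e. $\operatorname{supp}_B(u_i)\cap\operatorname{supp}_B(u_j)=\emptyset$ for all $i\neq j$.
   Context: An algebra over $\mathbb{K}$ is a $\mathbb{K}$-vector space with a bilinear product (not assumed associative or unital). A finite-dimensional evolution algebra over $\mathbb{K}$ is a finite-dimensional $\mathbb{K}$-algebra $\mathcal{E}$ which has a basis $B=\{e_1,\dots,e_n\}$, called a natural basis, such that $e_ie_j=0$ for all $i\neq j$. Writing $e_i^2=\sum_{j=1}^n a_{ij}e_j$, the matrix $M_B(\mathcal{E})=(a_{ij})_{i,j=1}^n$ is called the structure matrix of $\mathcal{E}$ relative to $B$. The evolution algebra $\mathcal{E}$ is regular if $\mathcal{E}=\mathcal{E}^2$ (where $\mathcal{E}^2$ is the linear span of all products), equivalently if $M_B(\mathcal{E})$ is non-singular. A subalgebra is a linear subspace closed under the product. For $u=\sum_{i=1}^n\mu_ie_i\in\mathcal{E}$, the support of $u$ is $\operatorname{supp}_B(u)=\{i:\mu_i\neq 0\}$. *)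

theory Defs
  imports Complex_Main
begin

locale nonassoc_algebra = vector_space scale
  for scale :: "'k::field \<Rightarrow> 'e::ab_group_add \<Rightarrow> 'e" +
  fixes mult :: "'e \<Rightarrow> 'e \<Rightarrow> 'e"
  assumes linear_mult_left: "\<And>y. Vector_Spaces.linear scale scale (\<lambda>x. mult x y)"
    and linear_mult_right: "\<And>x. Vector_Spaces.linear scale scale (\<lambda>y. mult x y)"

text \<open>Bases are families \<open>u\<^sub>1, \<dots>, u\<^sub>m\<close>; injectivity excludes repetitions, which are
  invisible in the set \<open>u ` {1..m}\<close>.\<close>

definition is_basis ::
  "('k::field \<Rightarrow> 'e::ab_group_add \<Rightarrow> 'e) \<Rightarrow> 'e set \<Rightarrow> nat \<Rightarrow> (nat \<Rightarrow> 'e) \<Rightarrow> bool" where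
  "is_basis scale U m u \<longleftrightarrow>
     inj_on u {1..m} \<and> \<not> module.dependent scale (u ` {1..m}) \<and>
     module.span scale (u ` {1..m}) = U"

definition natural_basis ::
  "('k::field \<Rightarrow> 'e::ab_group_add \<Rightarrow> 'e) \<Rightarrow> ('e \<Rightarrow> 'e \<Rightarrow> 'e) \<Rightarrow> nat \<Rightarrow> (nat \<Rightarrow> 'e) \<Rightarrow> bool" where
  "natural_basis scale mult n e \<longleftrightarrow>
     is_basis scale UNIV n e \<and> (\<forall>i\<in>{1..n}. \<forall>j\<in>{1..n}. i \<noteq> j \<longrightarrow> mult (e i) (e j) = 0)"

definition evolution_algebra ::
  "('k::field \<Rightarrow> 'e::ab_group_add \<Rightarrow> 'e) \<Rightarrow> ('e \<Rightarrow> 'e \<Rightarrow> 'e) \<Rightarrow> bool" where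
  "evolution_algebra scale mult \<longleftrightarrow>
     nonassoc_algebra scale mult \<and> (\<exists>n e. natural_basis scale mult n e)"

definition regular_evolution_algebra ::
  "('k::field \<Rightarrow> 'e::ab_group_add \<Rightarrow> 'e) \<Rightarrow> ('e \<Rightarrow> 'e \<Rightarrow> 'e) \<Rightarrow> bool" where
  "regular_evolution_algebra scale mult \<longleftrightarrow>
     evolution_algebra scale mult \<and> module.span scale {mult x y | x y. True} = UNIV"

definition subalgebra ::
  "('k::field \<Rightarrow> 'e::ab_group_add \<Rightarrow> 'e) \<Rightarrow> ('e \<Rightarrow> 'e \<Rightarrow> 'e) \<Rightarrow> 'e set \<Rightarrow> bool" where
  "subalgebra scale mult U \<longleftrightarrow>
     module.subspace scale U \<and> (\<forall>x\<in>U. \<forall>y\<in>U. mult x y \<in> U)"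

definition supp ::
  "('k::field \<Rightarrow> 'e::ab_group_add \<Rightarrow> 'e) \<Rightarrow> nat \<Rightarrow> (nat \<Rightarrow> 'e) \<Rightarrow> 'e \<Rightarrow> nat set" where
  "supp scale n e u =
     {i \<in> {1..n}. module.representation scale (e ` {1..n}) u (e i) \<noteq> 0}"

end

theory Submission
  imports Defs
begin

text \<open>
  Let \<open>e\<^sub>1, \<dots>, e\<^sub>n\<close> be the natural basis. Choose a minimal set \<open>P\<close> of indices such that no nonzero
  vector of \<open>U\<close> vanishes on all of \<open>P\<close>; minimality yields a basis \<open>(v\<^sub>p)\<close> of \<open>U\<close> indexed by
  \<open>P\<close> in which \<open>v\<^sub>p\<close> has coordinate \<open>1\<close> at \<open>p\<close> and \<open>0\<close> at the other elements of \<open>P\<close>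
  (a reduced echelon basis). As \<open>x y = \<Sum>\<^sub>i x\<^sub>i y\<^sub>i e\<^sub>i\<^sup>2\<close> and the \<open>e\<^sub>i\<^sup>2\<close> are independent by
  regularity, comparing coefficients at \<open>i \<in> P\<close> shows that the squares \<open>v\<^sub>p\<^sup>2\<close> are independent,
  hence form a basis of \<open>U\<close>. For \<open>p \<noteq> q\<close> write \<open>v\<^sub>p v\<^sub>q = \<Sum>\<^sub>r c\<^sub>r v\<^sub>r\<^sup>2\<close>; the coefficient at
  \<open>e\<^sub>r\<^sup>2\<close>, \<open>r \<in> P\<close>, gives \<open>c\<^sub>r = 0\<close>. So \<open>v\<^sub>p v\<^sub>q = 0\<close>, which says that
  the supports of \<open>v\<^sub>p\<close> and \<open>v\<^sub>q\<close> are disjoint.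
\<close>

section \<open>Finite indexed families in a vector space\<close>

context vector_space
begin

lemma independent_family_coeff_zero:
  assumes "finite I" "inj_on f I" "independent (f ` I)"
    and "(\<Sum>i\<in>I. scale (c i) (f i)) = 0" "i \<in> I"
  shows "c i = 0"
proof -
  have "(\<Sum>v\<in>f ` I. scale (c (the_inv_into I f v)) v) = (\<Sum>i\<in>I. scale (c i) (f i))"
    using assms(2) by (simp add: sum.reindex the_inv_into_f_f)
  then have "c (the_inv_into I f (f i)) = 0"
    using assms by (intro independentD[of "f ` I" "f ` I" "\<lambda>v. c (the_inv_into I f v)"]) auto
  then show ?thesis
    using assms(2,5) by (simp add: the_inv_into_f_f)
qed

lemma independent_familyI:
  assumes "finite I"
    and zero: "\<And>c i. (\<Sum>i\<in>I. scale (c i) (f i)) = 0 \<Longrightarrow> i \<in> I \<Longrightarrow> c i = 0"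
  shows "inj_on f I" "independent (f ` I)"
proof -
  show inj: "inj_on f I"
  proof (rule inj_onI, rule ccontr)
    fix i j assume ij: "i \<in> I" "j \<in> I" "f i = f j" "i \<noteq> j"
    \<comment> \<open>A repetition \<open>f i = f j\<close> would give the relation with coefficient
      1 at \<open>i\<close> and -1 at \<open>j\<close>, against \<open>zero\<close>.\<close>
    define c where "c k = (if k = i then 1 else 0) - (if k = j then 1 else (0::'a))" for k
    have "(\<Sum>k\<in>I. scale (c k) (f k)) =
        (\<Sum>k\<in>I. if k = i then f i else 0) - (\<Sum>k\<in>I. if k = j then f j else 0)"
      unfolding sum_subtractf[symmetric]
      by (rule sum.cong) (auto simp: c_def scale_left_diff_distrib)
    also have "\<dots> = 0"
      using assms(1) ij by simp
    finally have "c i = 0"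
      using zero ij(1) by blast
    then show False
      using ij(4) by (simp add: c_def)
  qed
  show "independent (f ` I)"
    using assms(1)
  proof (intro independent_if_scalars_zero ballI)
    fix c x assume c: "(\<Sum>x\<in>f ` I. scale (c x) x) = 0" and "x \<in> f ` I"
    then show "c x = 0"
      using zero[of "\<lambda>i. c (f i)"] inj by (auto simp: sum.reindex)
  qed simp
qed

lemma span_family_coeffs:
  assumes "finite I" "x \<in> span (f ` I)"
  obtains c where "x = (\<Sum>i\<in>I. scale (c i) (f i))"
proof -
  have "\<exists>c. x = (\<Sum>i\<in>I. scale (c i) (f i))"
    using assms(2)
  proof (induction rule: span_induct_alt)
    case base
    show ?case by (intro exI[of _ "\<lambda>_. 0"]) simp
  next
    case (step a y z)
    then obtain c j where "z = (\<Sum>i\<in>I. scale (c i) (f i))" and j: "j \<in> I" "y = f j"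
      by blast
    moreover have "(\<Sum>i\<in>I. scale (if i = j then a else 0) (f i)) = scale a y"
      using assms(1) j by (simp add: if_distrib[of "\<lambda>a. scale a _"] cong: if_cong)
    ultimately have "scale a y + z = (\<Sum>i\<in>I. scale ((if i = j then a else 0) + c i) (f i))"
      by (simp add: scale_left_distrib sum.distrib)
    then show ?case
      by (intro exI[of _ "\<lambda>i. (if i = j then a else 0) + c i"])
  qed
  then show thesis using that by blast
qed

text \<open>A maximal independent subset of the family still spans \<open>B\<close>, so by the
  exchange bound it has at least \<open>card I\<close> elements: no member is redundant or
  repeated.\<close>

lemma spanning_family_card_le_imp_independent:
  assumes "finite I" "independent B" "B \<subseteq> span (f ` I)" "card I \<le> card B"
  shows "inj_on f I" "independent (f ` I)"
proof -
  obtain C where C: "C \<subseteq> f ` I" "independent C" "f ` I \<subseteq> span C"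
    using maximal_independent_subset by blast
  have fin: "finite C"
    using C(1) assms(1) finite_surj by blast
  have "B \<subseteq> span C"
    using assms(3) C(3) span_minimal subspace_span by blast
  then have "card I \<le> card C"
    using independent_span_bound[OF fin assms(2)] assms(4) by linarith
  moreover have "card C \<le> card (f ` I)" "card (f ` I) \<le> card I"
    using C(1) assms(1) by (simp_all add: card_mono card_image_le)
  ultimately have "card C = card (f ` I)" "card (f ` I) = card I"
    by linarith+
  then show "inj_on f I" "independent (f ` I)"
    using C(1,2) assms(1) card_subset_eq[of "f ` I" C] eq_card_imp_inj_on by auto
qed

text \<open>A vector of \<open>span B\<close> outside \<open>span A\<close> would extend
  \<open>A\<close> to an independent set with more than \<open>card B\<close> elements.\<close>

lemma independent_card_ge_imp_spanning:
  assumes "finite B" "independent A" "A \<subseteq> span B" "card B \<le> card A"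
  shows "span B \<subseteq> span A"
proof
  fix x assume x: "x \<in> span B"
  show "x \<in> span A"
  proof (rule ccontr)
    assume not: "x \<notin> span A"
    then have "independent (insert x A)"
      using assms(2) by (simp add: independent_insert)
    moreover have "insert x A \<subseteq> span B"
      using assms(3) x by simp
    ultimately have "finite (insert x A)" "card (insert x A) \<le> card B"
      using independent_span_bound[OF assms(1), of "insert x A"] by simp_all
    moreover have "x \<notin> A"
      using not span_base by blast
    ultimately show False
      using assms(4) by simp
  qed
qed

text \<open>A reduced echelon basis without row reduction: pivots are a minimal set of functionals
  that still separates the vectors of \<open>U\<close>.\<close>

lemma pivot_basis:
  fixes \<phi> :: "'i \<Rightarrow> 'b \<Rightarrow> 'a"
  assumes "finite I" "subspace U"
    and lin: "\<And>i. i \<in> I \<Longrightarrow> Vector_Spaces.linear scale (*) (\<phi> i)"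
    and separating: "\<And>x. x \<in> U \<Longrightarrow> (\<And>i. i \<in> I \<Longrightarrow> \<phi> i x = 0) \<Longrightarrow> x = 0"
  obtains P v where "P \<subseteq> I" "\<And>p. p \<in> P \<Longrightarrow> v p \<in> U"
    "\<And>p q. p \<in> P \<Longrightarrow> q \<in> P \<Longrightarrow> \<phi> q (v p) = (if p = q then 1 else 0)"
    "inj_on v P" "independent (v ` P)" "span (v ` P) = U"
proof -
  define sep where "sep P \<longleftrightarrow> (\<forall>x\<in>U. (\<forall>i\<in>P. \<phi> i x = 0) \<longrightarrow> x = 0)" for P
  have "finite {P. P \<subseteq> I \<and> sep P}" "I \<in> {P. P \<subseteq> I \<and> sep P}"
    using assms(1) separating by (auto simp: sep_def)
  from finite_has_minimal2[OF this]
  obtain P where P: "P \<subseteq> I" "sep P" and min: "\<And>Q. Q \<subseteq> I \<Longrightarrow> sep Q \<Longrightarrow> Q \<subseteq> P \<Longrightarrow> P = Q"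
    by auto
  have finP: "finite P"
    using P(1) assms(1) finite_subset by blast
  have "\<exists>v\<in>U. \<forall>q\<in>P. \<phi> q v = (if p = q then 1 else 0)" if p: "p \<in> P" for p
  proof -
    \<comment> \<open>By minimality some nonzero \<open>w\<close> in \<open>U\<close> is killed by
      every functional of \<open>P\<close> except \<open>p\<close>. Since \<open>P\<close>
      separates, \<open>\<phi> p w\<close> is nonzero, and rescaling makes it 1.\<close>
    have "\<not> sep (P - {p})"
      using min[of "P - {p}"] P(1) p by blast
    then obtain w where w: "w \<in> U" "\<forall>i\<in>P - {p}. \<phi> i w = 0" "w \<noteq> 0"
      unfolding sep_def by blast
    then have "\<phi> p w \<noteq> 0"
      using P(2) unfolding sep_def by (metis Diff_iff singletonD)
    moreover have "\<phi> q (scale (inverse (\<phi> p w)) w) = inverse (\<phi> p w) * \<phi> q w" if "q \<in> P" for q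
      using lin P(1) that by (simp add: Vector_Spaces.linear_iff subset_iff)
    ultimately show ?thesis
      using w assms(2)
      by (intro bexI[of _ "scale (inverse (\<phi> p w)) w"]) (auto simp: subspace_scale)
  qed
  then obtain v where v: "\<And>p. p \<in> P \<Longrightarrow> v p \<in> U"
    "\<And>p q. p \<in> P \<Longrightarrow> q \<in> P \<Longrightarrow> \<phi> q (v p) = (if p = q then 1 else 0)"
    by metis
  have coeff: "\<phi> q (\<Sum>p\<in>P. scale (c p) (v p)) = c q" if "q \<in> P" for c q
  proof -
    interpret \<phi>: Vector_Spaces.linear scale "(*)" "\<phi> q"
      using lin P(1) that by blast
    have "\<phi> q (\<Sum>p\<in>P. scale (c p) (v p)) = (\<Sum>p\<in>P. if p = q then c q else 0)"
      unfolding \<phi>.sum \<phi>.scale using v(2) that by (intro sum.cong) auto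
    then show ?thesis
      using finP that by simp
  qed
  have zero: "c p = 0" if "(\<Sum>p\<in>P. scale (c p) (v p)) = 0" "p \<in> P" for c p
  proof -
    interpret \<phi>: Vector_Spaces.linear scale "(*)" "\<phi> p"
      using lin P(1) that by blast
    show ?thesis
      using coeff[OF that(2), of c] that(1) by simp
  qed
  have "U \<subseteq> span (v ` P)"
  proof
    fix x assume x: "x \<in> U"
    \<comment> \<open>The only candidate: \<open>y\<close> agrees with \<open>x\<close> under every
      functional of \<open>P\<close>, so \<open>x - y\<close> must vanish.\<close>
    define y where "y = (\<Sum>p\<in>P. scale (\<phi> p x) (v p))"
    have y: "y \<in> span (v ` P)"
      unfolding y_def by (intro span_sum span_scale span_base) simp
    have "y \<in> U"
      unfolding y_def using assms(2) v(1) by (intro subspace_sum subspace_scale)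
    then have "x - y \<in> U"
      using x assms(2) subspace_diff by blast
    moreover have "\<phi> q (x - y) = 0" if "q \<in> P" for q
    proof -
      interpret \<phi>: Vector_Spaces.linear scale "(*)" "\<phi> q"
        using lin P(1) that by blast
      show ?thesis
        using coeff[OF that] by (simp add: \<phi>.diff y_def)
    qed
    ultimately have "x - y = 0"
      using P(2) unfolding sep_def by blast
    then show "x \<in> span (v ` P)"
      using y by simp
  qed
  moreover have "span (v ` P) \<subseteq> U"
    using v(1) assms(2) by (intro span_minimal) auto
  moreover have "inj_on v P" "independent (v ` P)"
    using independent_familyI[OF finP, of v] zero by blast+
  ultimately show thesis
    using that[OF P(1) v] by blast
qed

end

section \<open>Subalgebras of a regular evolution algebra\<close>

theorem corollary4:
  fixes scale :: "'k::field \<Rightarrow> 'e::ab_group_add \<Rightarrow> 'e"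
    and mult :: "'e \<Rightarrow> 'e \<Rightarrow> 'e"
    and n :: nat and e :: "nat \<Rightarrow> 'e" and U :: "'e set"
  assumes "regular_evolution_algebra scale mult"
    and "natural_basis scale mult n e"
    and "subalgebra scale mult U"
  shows "\<exists>m u. is_basis scale U m u \<and>
    (\<forall>i\<in>{1..m}. \<forall>j\<in>{1..m}. i \<noteq> j \<longrightarrow> supp scale n e (u i) \<inter> supp scale n e (u j) = {})"
proof -
  interpret nonassoc_algebra scale mult
    using assms(1) by (simp add: regular_evolution_algebra_def evolution_algebra_def)
  define I where "I = {1..n}"
  define coord where "coord i x = representation (e ` I) x (e i)" for i x
  define sq where "sq x = mult x x" for x
  have regular: "span {mult x y | x y. True} = UNIV"
    using assms(1) by (simp add: regular_evolution_algebra_def)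
  have finI: "finite I" and e: "inj_on e I" "independent (e ` I)" "span (e ` I) = UNIV"
    and orth: "\<And>i j. i \<in> I \<Longrightarrow> j \<in> I \<Longrightarrow> i \<noteq> j \<Longrightarrow> mult (e i) (e j) = 0"
    using assms(2) by (auto simp: natural_basis_def is_basis_def I_def)
  have U: "subspace U" "\<And>x y. x \<in> U \<Longrightarrow> y \<in> U \<Longrightarrow> mult x y \<in> U"
    using assms(3) by (auto simp: subalgebra_def)
  have lin_coord: "Vector_Spaces.linear scale (*) (coord i)" for i
    using e(2,3)
    by unfold_locales (simp_all add: coord_def representation_add representation_scale algebra_simps)
  have expand: "x = (\<Sum>i\<in>I. scale (coord i x) (e i))" for x
    using sum_representation_eq[of "e ` I" x "e ` I"] e finI
    by (simp add: coord_def sum.reindex)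
  have mult_eq: "mult x y = (\<Sum>i\<in>I. scale (coord i x * coord i y) (sq (e i)))" for x y
  proof -
    interpret left: Vector_Spaces.linear scale scale "\<lambda>a. mult a b" for b
      by (rule linear_mult_left)
    interpret right: Vector_Spaces.linear scale scale "mult a" for a
      by (rule linear_mult_right)
    have "mult (e i) y = scale (coord i y) (sq (e i))" if "i \<in> I" for i
    proof -
      have "mult (e i) y = (\<Sum>j\<in>I. scale (coord j y) (mult (e i) (e j)))"
        by (subst expand[of y]) (simp add: right.sum right.scale)
      also have "\<dots> = (\<Sum>j\<in>I. if j = i then scale (coord i y) (sq (e i)) else 0)"
        using orth that by (intro sum.cong) (auto simp: sq_def)
      finally show ?thesis
        using finI that by simp
    qed
    then have "(\<Sum>i\<in>I. scale (coord i x) (mult (e i) y)) = 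
        (\<Sum>i\<in>I. scale (coord i x * coord i y) (sq (e i)))"
      by simp
    then show ?thesis
      by (subst expand[of x]) (simp add: left.sum left.scale)
  qed
  \<comment> \<open>Regularity enters here: the squares of the natural basis span the whole space
    and are indexed by \<open>I\<close>, so counting makes them independent.\<close>
  have "mult x y \<in> span ((\<lambda>i. sq (e i)) ` I)" for x y
    unfolding mult_eq[of x y] by (intro span_sum span_scale span_base) simp
  then have "span {mult x y | x y. True} \<subseteq> span ((\<lambda>i. sq (e i)) ` I)"
    by (intro span_minimal) auto
  then have "e ` I \<subseteq> span ((\<lambda>i. sq (e i)) ` I)"
    using regular by auto
  then have indep_sq: "inj_on (\<lambda>i. sq (e i)) I" "independent ((\<lambda>i. sq (e i)) ` I)"
    using spanning_family_card_le_imp_independent[OF finI e(2)] e(1) by (simp_all add: card_image)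
  have coeff: "a i = b i"
    if "(\<Sum>i\<in>I. scale (a i) (sq (e i))) = (\<Sum>i\<in>I. scale (b i) (sq (e i)))" "i \<in> I" for a b i
    using independent_family_coeff_zero[OF finI indep_sq, of "\<lambda>i. a i - b i"] that
    by (simp add: scale_left_diff_distrib sum_subtractf)

  obtain P v where P: "P \<subseteq> I" and v: "\<And>p. p \<in> P \<Longrightarrow> v p \<in> U"
    "\<And>p q. p \<in> P \<Longrightarrow> q \<in> P \<Longrightarrow> coord q (v p) = (if p = q then 1 else 0)"
    "inj_on v P" "independent (v ` P)" "span (v ` P) = U"
  proof (rule pivot_basis[OF finI U(1) lin_coord])
    show "x = 0" if "\<And>i. i \<in> I \<Longrightarrow> coord i x = 0" for x
      using expand[of x] that by simp
  qed blast
  have finP: "finite P"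
    using P finI finite_subset by blast
  have coeff_sq: "coord q x * coord q y = c q"
    if "mult x y = (\<Sum>p\<in>P. scale (c p) (sq (v p)))" "q \<in> P" for x y c q
  proof -
    have "(\<Sum>i\<in>I. scale (coord i x * coord i y) (sq (e i))) =
        (\<Sum>p\<in>P. \<Sum>i\<in>I. scale (c p * (coord i (v p) * coord i (v p))) (sq (e i)))"
      using that(1) by (simp add: mult_eq sq_def[of "v _"] scale_sum_right)
    also have "\<dots> = (\<Sum>i\<in>I. scale (\<Sum>p\<in>P. c p * (coord i (v p) * coord i (v p))) (sq (e i)))"
      by (subst sum.swap) (simp add: scale_sum_left)
    finally have "coord q x * coord q y = (\<Sum>p\<in>P. c p * (coord q (v p) * coord q (v p)))"
      by (rule coeff) (use P that(2) in blast)
    \<comment> \<open>At a pivot \<open>q\<close> only \<open>v q\<close> has a nonzero coordinate,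
      and it is 1.\<close>
    also have "\<dots> = (\<Sum>p\<in>P. if p = q then c q else 0)"
      using v(2) that(2) by (intro sum.cong) auto
    finally show ?thesis
      using finP that(2) by simp
  qed
  \<comment> \<open>A vanishing combination is read as the product of 0 with 0, whose coordinates
    are all zero.\<close>
  have sq_zero: "c p = 0" if "(\<Sum>p\<in>P. scale (c p) (sq (v p))) = 0" "p \<in> P" for c p
    using coeff_sq[of 0 0 c p] that by (simp add: mult_eq[of 0 0] coord_def representation_zero)
  have indep_sqv: "inj_on (\<lambda>p. sq (v p)) P" "independent ((\<lambda>p. sq (v p)) ` P)"
    using independent_familyI[OF finP, of "\<lambda>p. sq (v p)"] sq_zero by blast+
  \<comment> \<open>Closure under products puts the squares in \<open>U\<close>; being independent
    and as many as the \<open>v p\<close>, they span it.\<close>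
  have "span (v ` P) \<subseteq> span ((\<lambda>p. sq (v p)) ` P)"
    using indep_sqv v U(2) finP
    by (intro independent_card_ge_imp_spanning) (auto simp: sq_def card_image)
  then have span_sq: "U \<subseteq> span ((\<lambda>p. sq (v p)) ` P)"
    using v(5) by simp
  have disjoint: "coord i (v p) * coord i (v q) = 0"
    if pq: "p \<in> P" "q \<in> P" "p \<noteq> q" and i: "i \<in> I" for p q i
  proof -
    have "mult (v p) (v q) \<in> span ((\<lambda>p. sq (v p)) ` P)"
      using U(2) v(1) pq span_sq by blast
    then obtain c where c: "mult (v p) (v q) = (\<Sum>p\<in>P. scale (c p) (sq (v p)))"
      using span_family_coeffs[OF finP] by blast
    \<comment> \<open>\<open>r\<close> differs from \<open>p\<close> or from \<open>q\<close>, so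
      \<open>v p\<close> or \<open>v q\<close> has coordinate 0 at \<open>r\<close>.\<close>
    have "c r = 0" if "r \<in> P" for r
      using coeff_sq[OF c that] v(2) pq that by (auto split: if_splits)
    then have "mult (v p) (v q) = 0"
      using c by simp
    \<comment> \<open>Independence of the \<open>sq (e i)\<close> passes from the zero product to
      each index \<open>i\<close>, including those outside \<open>P\<close>.\<close>
    then show ?thesis
      using independent_family_coeff_zero[OF finI indep_sq, of "\<lambda>i. coord i (v p) * coord i (v q)"] i
      by (simp add: mult_eq)
  qed

  \<comment> \<open>\<open>is_basis\<close> requires the index set \<open>{1..m}\<close>, so the
    pivots are renumbered.\<close>
  obtain h where h: "bij_betw h {1..card P} P"
    using ex_bij_betw_nat_finite_1[OF finP] by blast
  have "is_basis scale U (card P) (v \<circ> h)"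
    using h v(3-5) unfolding is_basis_def bij_betw_def
    by (metis comp_inj_on image_comp)
  moreover have "supp scale n e ((v \<circ> h) i) \<inter> supp scale n e ((v \<circ> h) j) = {}"
    if "i \<in> {1..card P}" "j \<in> {1..card P}" "i \<noteq> j" for i j
  proof -
    have "h i \<in> P" "h j \<in> P" "h i \<noteq> h j"
      using h that unfolding bij_betw_def by (auto dest: inj_onD)
    then show ?thesis
      using disjoint[of "h i" "h j"] by (auto simp: supp_def coord_def I_def)
  qed
  ultimately show ?thesis by blast
qed

end
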